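(* Let $A,B,C$ be a Leonard triple on $V$ that has $q$-Racah type with Huang data $(a,b,c,d)$, and let $\overline A=W^{-1}BW-C$ with $W$ as defined in the context. (i) If $a=q^{d+1}$, then $\overline A=(b-c)(b-c^{-1})b^{-1}[d+1]_q\,E_0$. (ii) If $a=q^{-d-1}$, then $\overline A=(b-c)(b-c^{-1})b^{-1}[d+1]_q\,E_d$. (iii) If $a\ne q^{d+1}$ and $a\neq q^{-d-1}$, then $\overline A=(\alpha_b-\alpha_c)\left(I-\frac{A}{q+q^{-1}}\right)^{-1}$.
   Context: Let $\mathbb F$ be a field, $d\ge 0$ an integer, $V$ a vector space over $\mathbb F$ of dimension $d+1$, $\mathrm{End}(V)$ the $\mathbb F$-algebra of $\mathbb F$-linear maps $V\to V$, and $I$ its identity. A square matrix is tridiagonal if each nonzero entry lies on the diagonal, subdiagonal or superdiagonal; a tridiagonal matrix is irreducible if every subdiagonal entry and every superdiagonal entry is nonzero. Leonard triple on $V$: a 3-tuple $A,B,C$ of elements of $\mathrm{End}(V)$ such that (i) there is a basis of $V$ with respect to which $A$ is represented by a diagonal matrix and $B,C$ by irreducible tridiagonal matrices; (ii) there is a basis with respect to which $B$ is diagonal and $C,A$ are irreducible tridiagonal; (iii) there is a basis with respect to which $C$ is diagonal and $A,B$ are irreducible tridiagonal. Each of $A,B,C$ is then diagonalizable with one-dimensional eigenspaces. An ordering of the eigenvalues of $A$ is standard if corresponding eigenvectors, in that order, form a basis as in (i); similarly for $B$ with (ii) and $C$ with (iii). Standing assumptions: fix a nonzero $q\in\mathbb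 F$ with $q^4\ne 1$ and nonzero $a,b,c\in\mathbb F$ such that $q^{2i}\ne 1$ for $1\le i\le d$; none of $a^2,b^2,c^2$ is among $q^{2d-2},q^{2d-4},\ldots,q^{2-2d}$; none of $abc,a^{-1}bc,ab^{-1}c,abc^{-1}$ is among $q^{d-1},q^{d-3},\ldots,q^{1-d}$. For $0\le i\le d$ let $\theta_i=aq^{2i-d}+a^{-1}q^{d-2i}$, $\theta'_i=bq^{2i-d}+b^{-1}q^{d-2i}$, $\theta''_i=cq^{2i-d}+c^{-1}q^{d-2i}$. A Leonard triple $A,B,C$ on $V$ has $q$-Racah type with Huang data $(a,b,c,d)$ if $\{\theta_i\}_{i=0}^d$, $\{\theta'_i\}_{i=0}^d$, $\{\theta''_i\}_{i=0}^d$ are standard orderings of the eigenvalues of $A$, $B$, $C$ respectively, and $$A+\frac{qBC-q^{-1}CB}{q^2-q^{-2}}=\alpha_a I,\quad B+\frac{qCA-q^{-1}AC}{q^2-q^{-2}}=\alpha_b I,\quad C+\frac{qAB-q^{-1}BA}{q^2-q^{-2}}=\alpha_c I,$$ where $\alpha_a=\frac{(a+a^{-1})(q^{d+1}+q^{-d-1})+(b+b^{-1})(c+c^{-1})}{q+q^{-1}}$, $\alpha_b=\frac{(b+b^{-1})(q^{d+1}+q^{-d-1})+(c+c^{-1})(a+a^{-1})}{q+q^{-1}}$, $\alpha_c=\frac{(c+c^{-1})(q^{d+1}+q^{-d-1})+(a+a^{-1})(b+b^{-1})}{q+q^{-1}}$. For $0\le i\le d$ let $E_i$ be the primitive idempotent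 of $A$ for $\theta_i$: the projection of $V$ onto the $\theta_i$-eigenspace of $A$ that is zero on the other eigenspaces. Define $W=\sum_{i=0}^d(-1)^ia^{-i}q^{i(d-i)}E_i$, which is invertible. Also $[n]_q=\frac{q^n-q^{-n}}{q-q^{-1}}$ for $n\in\mathbb Z$. *)

theory Defs
  imports Complex_Main "Jordan_Normal_Form.Matrix"
begin

definition tridiagonal_mat :: "'a::zero mat \<Rightarrow> bool" where
  "tridiagonal_mat M \<longleftrightarrow> square_mat M \<and>
     (\<forall>i<dim_row M. \<forall>j<dim_col M. M $$ (i, j) \<noteq> 0 \<longrightarrow> i = j \<or> i = Suc j \<or> j = Suc i)"

definition irreducible_tridiagonal_mat :: "'a::zero mat \<Rightarrow> bool" where
  "irreducible_tridiagonal_mat M \<longleftrightarrow> tridiagonal_mat M \<and>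
     (\<forall>i. Suc i < dim_row M \<longrightarrow> M $$ (Suc i, i) \<noteq> 0 \<and> M $$ (i, Suc i) \<noteq> 0)"

definition q_number :: "'a::field \<Rightarrow> int \<Rightarrow> 'a" where
  "q_number q n = (q powi n - q powi (- n)) / (q - inverse q)"

text \<open>The eigenvalue sequences \<open>\<theta>\<^sub>i\<close>, \<open>\<theta>'\<^sub>i\<close>, \<open>\<theta>''\<^sub>i\<close> are
  \<open>qracah_eigenvalue q d x i\<close> with \<open>x = a, b, c\<close>.\<close>

definition qracah_eigenvalue :: "'a::field \<Rightarrow> nat \<Rightarrow> 'a \<Rightarrow> nat \<Rightarrow> 'a" where
  "qracah_eigenvalue q d x i =
     x * q powi (2 * int i - int d) + inverse x * q powi (int d - 2 * int i)"

text \<open>With \<open>qracah_alpha q d x y z\<close> one has \<open>\<alpha>\<^sub>a\<close>, \<open>\<alpha>\<^sub>b\<close>, \<open>\<alpha>\<^sub>c\<close> for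
  \<open>(x, y, z) = (a, b, c), (b, c, a), (c, a, b)\<close>.\<close>

definition qracah_alpha :: "'a::field \<Rightarrow> nat \<Rightarrow> 'a \<Rightarrow> 'a \<Rightarrow> 'a \<Rightarrow> 'a" where
  "qracah_alpha q d x y z =
     ((x + inverse x) * (q powi (int d + 1) + q powi (- int d - 1))
       + (y + inverse y) * (z + inverse z)) / (q + inverse q)"

text \<open>Ordered bases are families \<open>v 0, \<dots>, v d\<close>; values of \<open>v\<close> beyond \<open>d\<close> are irrelevant.\<close>

definition ordered_basis :: "('a::field \<Rightarrow> 'b::ab_group_add \<Rightarrow> 'b) \<Rightarrow>
     nat \<Rightarrow> (nat \<Rightarrow> 'b) \<Rightarrow> bool" where
  "ordered_basis scale d v \<longleftrightarrow>
     inj_on v {..d} \<and> \<not> module.dependent scale (v ` {..d}) \<and> module.span scale (v ` {..d}) = UNIV"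

text \<open>Column \<open>j\<close> holds the coordinates of \<open>f (v j)\<close>.\<close>

definition matrix_of :: "('a::field \<Rightarrow> 'b::ab_group_add \<Rightarrow> 'b) \<Rightarrow>
     nat \<Rightarrow> (nat \<Rightarrow> 'b) \<Rightarrow> ('b \<Rightarrow> 'b) \<Rightarrow> 'a mat" where
  "matrix_of scale d v f =
     mat (Suc d) (Suc d) (\<lambda>(i, j). module.representation scale (v ` {..d}) (f (v j)) (v i))"

definition leonard_basis ::
    "('a::field \<Rightarrow> 'b::ab_group_add \<Rightarrow> 'b) \<Rightarrow>
     nat \<Rightarrow> ('b \<Rightarrow> 'b) \<Rightarrow> ('b \<Rightarrow> 'b) \<Rightarrow> ('b \<Rightarrow> 'b) \<Rightarrow> (nat \<Rightarrow> 'b) \<Rightarrow> bool" where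
  "leonard_basis scale d A B C v \<longleftrightarrow>
     ordered_basis scale d v \<and>
     diagonal_mat (matrix_of scale d v A) \<and>
     irreducible_tridiagonal_mat (matrix_of scale d v B) \<and>
     irreducible_tridiagonal_mat (matrix_of scale d v C)"

definition leonard_triple ::
    "('a::field \<Rightarrow> 'b::ab_group_add \<Rightarrow> 'b) \<Rightarrow>
     nat \<Rightarrow> ('b \<Rightarrow> 'b) \<Rightarrow> ('b \<Rightarrow> 'b) \<Rightarrow> ('b \<Rightarrow> 'b) \<Rightarrow> bool" where
  "leonard_triple scale d A B C \<longleftrightarrow>
     Vector_Spaces.linear scale scale A \<and>
     Vector_Spaces.linear scale scale B \<and>
     Vector_Spaces.linear scale scale C \<and>
     (\<exists>v. leonard_basis scale d A B C v) \<and>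
     (\<exists>v. leonard_basis scale d B C A v) \<and>
     (\<exists>v. leonard_basis scale d C A B v)"

definition eigenspace :: "('a::field \<Rightarrow> 'b::ab_group_add \<Rightarrow> 'b) \<Rightarrow>
     ('b \<Rightarrow> 'b) \<Rightarrow> 'a \<Rightarrow> 'b set" where
  "eigenspace scale f k = {v. f v = scale k v}"

definition eigenvalues :: "('a::field \<Rightarrow> 'b::ab_group_add \<Rightarrow> 'b) \<Rightarrow>
     ('b \<Rightarrow> 'b) \<Rightarrow> 'a set" where
  "eigenvalues scale f = {k. \<exists>v. v \<noteq> 0 \<and> v \<in> eigenspace scale f k}"

text \<open>Standardness of an ordering of the eigenvalues of the first map \<open>A\<close>; for \<open>B\<close> and \<open>C\<close>
  the three maps are permuted cyclically.\<close>

definition standard_ordering ::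
    "('a::field \<Rightarrow> 'b::ab_group_add \<Rightarrow> 'b) \<Rightarrow>
     nat \<Rightarrow> ('b \<Rightarrow> 'b) \<Rightarrow> ('b \<Rightarrow> 'b) \<Rightarrow> ('b \<Rightarrow> 'b) \<Rightarrow> (nat \<Rightarrow> 'a) \<Rightarrow> bool" where
  "standard_ordering scale d A B C t \<longleftrightarrow>
     bij_betw t {..d} (eigenvalues scale A) \<and>
     (\<exists>v. (\<forall>i\<le>d. v i \<noteq> 0 \<and> v i \<in> eigenspace scale A (t i)) \<and> leonard_basis scale d A B C v)"

definition qracah_relation ::
    "('a::field \<Rightarrow> 'b::ab_group_add \<Rightarrow> 'b) \<Rightarrow>
     'a \<Rightarrow> 'a \<Rightarrow> ('b \<Rightarrow> 'b) \<Rightarrow> ('b \<Rightarrow> 'b) \<Rightarrow> ('b \<Rightarrow> 'b) \<Rightarrow> bool" where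
  "qracah_relation scale q \<alpha> A B C \<longleftrightarrow>
     (\<forall>v. A v + scale (inverse (q\<^sup>2 - inverse (q\<^sup>2)))
              (scale q (B (C v)) - scale (inverse q) (C (B v)))
          = scale \<alpha> v)"

definition qracah_huang_data ::
    "('a::field \<Rightarrow> 'b::ab_group_add \<Rightarrow> 'b) \<Rightarrow>
     'a \<Rightarrow> 'a \<Rightarrow> 'a \<Rightarrow> 'a \<Rightarrow> nat \<Rightarrow> ('b \<Rightarrow> 'b) \<Rightarrow> ('b \<Rightarrow> 'b) \<Rightarrow> ('b \<Rightarrow> 'b) \<Rightarrow> bool" where
  "qracah_huang_data scale q a b c d A B C \<longleftrightarrow>
     leonard_triple scale d A B C \<and>
     standard_ordering scale d A B C (qracah_eigenvalue q d a) \<and>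
     standard_ordering scale d B C A (qracah_eigenvalue q d b) \<and>
     standard_ordering scale d C A B (qracah_eigenvalue q d c) \<and>
     qracah_relation scale q (qracah_alpha q d a b c) A B C \<and>
     qracah_relation scale q (qracah_alpha q d b c a) B C A \<and>
     qracah_relation scale q (qracah_alpha q d c a b) C A B"

text \<open>The description determines the map uniquely when \<open>f\<close> is diagonalizable and \<open>k\<close> is one
  of its eigenvalues, as is the case below.\<close>

definition primitive_idempotent :: "('a::field \<Rightarrow> 'b::ab_group_add \<Rightarrow> 'b) \<Rightarrow>
     ('b \<Rightarrow> 'b) \<Rightarrow> 'a \<Rightarrow> 'b \<Rightarrow> 'b" where
  "primitive_idempotent scale f k =
     (THE E. Vector_Spaces.linear scale scale E \<and> E \<circ> E = E \<and>
        range E = eigenspace scale f k \<and>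
        (\<forall>l. l \<noteq> k \<longrightarrow> (\<forall>v\<in>eigenspace scale f l. E v = 0)))"

definition qracah_idempotent :: "('a::field \<Rightarrow> 'b::ab_group_add \<Rightarrow> 'b) \<Rightarrow>
     'a \<Rightarrow> 'a \<Rightarrow> nat \<Rightarrow> ('b \<Rightarrow> 'b) \<Rightarrow> nat \<Rightarrow> 'b \<Rightarrow> 'b" where
  "qracah_idempotent scale q a d A i = primitive_idempotent scale A (qracah_eigenvalue q d a i)"

definition W_map :: "('a::field \<Rightarrow> 'b::ab_group_add \<Rightarrow> 'b) \<Rightarrow>
     'a \<Rightarrow> 'a \<Rightarrow> nat \<Rightarrow> ('b \<Rightarrow> 'b) \<Rightarrow> 'b \<Rightarrow> 'b" where
  "W_map scale q a d A = (\<lambda>v. \<Sum>i\<le>d.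
     scale ((- 1) ^ i * a powi (- int i) * q powi (int i * (int d - int i)))
       (qracah_idempotent scale q a d A i v))"

text \<open>\<open>W\<^sup>-\<^sup>1 B W - C\<close>, where \<open>W\<^sup>-\<^sup>1\<close> is the inverse function of the bijection \<open>W\<close>.\<close>

definition A_bar ::
    "('a::field \<Rightarrow> 'b::ab_group_add \<Rightarrow> 'b) \<Rightarrow>
     'a \<Rightarrow> 'a \<Rightarrow> nat \<Rightarrow> ('b \<Rightarrow> 'b) \<Rightarrow> ('b \<Rightarrow> 'b) \<Rightarrow> ('b \<Rightarrow> 'b) \<Rightarrow> 'b \<Rightarrow> 'b" where
  "A_bar scale q a d A B C =
     (\<lambda>v. inv_into UNIV (W_map scale q a d A) (B (W_map scale q a d A v)) - C v)"

end

theory Submission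
  imports Defs
begin

text \<open>
  Everything is computed in an eigenbasis \<open>v\<^sub>0, \<dots>, v\<^sub>d\<close> of \<open>A\<close>, ordered so that \<open>B\<close> and \<open>C\<close> are
  tridiagonal. There \<open>A\<close>, \<open>W\<close>, the idempotents \<open>E\<^sub>i\<close> and \<open>I - A/(q + q\<^sup>-\<^sup>1)\<close> are all diagonal, and
  the claim turns out to be an identity between diagonal matrices.

  The third defining relation expresses \<open>C\<close> through \<open>A\<close> and \<open>B\<close>, so that off the diagonal
  \<open>C\<^sub>i\<^sub>j\<close> is \<open>- (q \<theta>\<^sub>i - q\<^sup>-\<^sup>1 \<theta>\<^sub>j)/(q\<^sup>2 - q\<^sup>-\<^sup>2)\<close> times \<open>B\<^sub>i\<^sub>j\<close>. For neighbouring indices this factor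
  is a monomial in \<open>a\<close> and \<open>q\<close>, and the weights \<open>w\<^sub>i\<close> of \<open>W\<close> are chosen such that it equals
  \<open>w\<^sub>j/w\<^sub>i\<close>. Hence \<open>W\<^sup>-\<^sup>1 B W\<close> and \<open>C\<close> have the same off-diagonal entries, and their difference
  is the diagonal map with entries \<open>\<delta>\<^sub>j = B\<^sub>j\<^sub>j - C\<^sub>j\<^sub>j\<close> (\<open>conjugate_diagonal\<close>).

  The diagonal parts of the second and third relations are two linear equations in \<open>B\<^sub>j\<^sub>j\<close> and
  \<open>C\<^sub>j\<^sub>j\<close>; subtracting them gives \<open>\<delta>\<^sub>j (1 - \<theta>\<^sub>j/(q + q\<^sup>-\<^sup>1)) = \<alpha>\<^sub>b - \<alpha>\<^sub>c\<close> (\<open>diagonal_difference\<close>).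
  The restrictions on \<open>a\<^sup>2\<close> allow \<open>\<theta>\<^sub>j = q + q\<^sup>-\<^sup>1\<close> only for \<open>j = 0\<close>, \<open>a = q\<^sup>d\<^sup>+\<^sup>1\<close> and for \<open>j = d\<close>,
  \<open>a = q\<^sup>-\<^sup>d\<^sup>-\<^sup>1\<close> (\<open>qracah_eigenvalue_exceptional\<close>). In the generic case one divides and obtains
  the resolvent formula. In an exceptional case the equation forces \<open>\<alpha>\<^sub>b = \<alpha>\<^sub>c\<close> and kills every
  \<open>\<delta>\<^sub>j\<close> but one. It says nothing about that last entry, which is instead found as the trace
  \<open>tr B - tr C\<close>, the difference of the two eigenvalue sums.
\<close>

section \<open>Coordinates and diagonal maps\<close>

locale coordinates = vector_space scale
  for scale :: "'a::field \<Rightarrow> 'v::ab_group_add \<Rightarrow> 'v" (infixr "*s" 75) +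
  fixes d :: nat and v :: "nat \<Rightarrow> 'v"
  assumes basis: "ordered_basis (*s) d v"
begin

definition crd :: "nat \<Rightarrow> 'v \<Rightarrow> 'a" where
  "crd i x = representation (v ` {..d}) x (v i)"

definition diag :: "(nat \<Rightarrow> 'a) \<Rightarrow> 'v \<Rightarrow> 'v" where
  "diag t x = (\<Sum>i\<le>d. (t i * crd i x) *s v i)"

lemma inj_v: "inj_on v {..d}" and indep: "independent (v ` {..d})"
  and spans: "span (v ` {..d}) = UNIV"
  using basis by (auto simp: ordered_basis_def)

lemma crd_add [simp]: "crd i (x + y) = crd i x + crd i y"
  using indep spans by (simp add: crd_def representation_add)

lemma crd_zero [simp]: "crd i 0 = 0"
  by (simp add: crd_def representation_zero)

lemma crd_scale [simp]: "crd i (k *s x) = k * crd i x"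
  using indep spans by (simp add: crd_def representation_scale)

lemma crd_diff [simp]: "crd i (x - y) = crd i x - crd i y"
  using indep spans by (simp add: crd_def representation_diff)

lemma crd_sum [simp]: "crd i (sum f S) = (\<Sum>j\<in>S. crd i (f j))"
  using indep spans by (simp add: crd_def representation_sum)

lemma crd_basis [simp]: "i \<le> d \<Longrightarrow> j \<le> d \<Longrightarrow> crd i (v j) = (if i = j then 1 else 0)"
  using indep inj_v by (auto simp: crd_def representation_basis inj_on_def)

lemma expand: "(\<Sum>i\<le>d. crd i x *s v i) = x"
proof -
  have "(\<Sum>i\<le>d. crd i x *s v i) = (\<Sum>b\<in>v ` {..d}. representation (v ` {..d}) x b *s b)"
    using inj_v by (simp add: sum.reindex crd_def)
  also have "\<dots> = x"
    using indep spans by (intro sum_representation_eq) auto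
  finally show ?thesis .
qed

lemma crd_ext:
  assumes "\<And>i. i \<le> d \<Longrightarrow> crd i x = crd i y"
  shows "x = y"
proof -
  have "(\<Sum>i\<le>d. crd i x *s v i) = (\<Sum>i\<le>d. crd i y *s v i)"
    by (intro sum.cong) (simp_all add: assms)
  then show ?thesis by (simp add: expand)
qed

lemma linear_expand:
  assumes "Vector_Spaces.linear (*s) (*s) f"
  shows "f x = (\<Sum>j\<le>d. crd j x *s f (v j))"
proof -
  interpret f: Vector_Spaces.linear "(*s)" "(*s)" f by fact
  have "f x = f (\<Sum>j\<le>d. crd j x *s v j)" by (simp add: expand)
  also have "\<dots> = (\<Sum>j\<le>d. crd j x *s f (v j))" by (simp add: f.sum f.scale)
  finally show ?thesis .
qed

lemma linear_ext:
  assumes "Vector_Spaces.linear (*s) (*s) f" "Vector_Spaces.linear (*s) (*s) g"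
    and "\<And>i. i \<le> d \<Longrightarrow> f (v i) = g (v i)"
  shows "f = g"
proof
  fix x
  have "(\<Sum>j\<le>d. crd j x *s f (v j)) = (\<Sum>j\<le>d. crd j x *s g (v j))"
    by (intro sum.cong) (simp_all add: assms(3))
  then show "f x = g x"
    by (metis linear_expand assms(1,2))
qed

lemma linear_if_add_scale:
  assumes "\<And>x y. f (x + y) = f x + f y" "\<And>k x. f (k *s x) = k *s f x"
  shows "Vector_Spaces.linear (*s) (*s) f"
  using assms by unfold_locales auto

lemma crd_diag [simp]: "i \<le> d \<Longrightarrow> crd i (diag t x) = t i * crd i x"
  by (simp add: diag_def if_distrib [where f = "\<lambda>y. _ * y"] sum.delta' cong: if_cong)

lemma linear_diag: "Vector_Spaces.linear (*s) (*s) (diag t)"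
  by (rule linear_if_add_scale; rule crd_ext) (auto simp: algebra_simps)

lemma diag_basis: "j \<le> d \<Longrightarrow> diag t (v j) = t j *s v j"
  by (rule crd_ext) auto

lemma diag_unique:
  assumes "Vector_Spaces.linear (*s) (*s) f" "\<And>i. i \<le> d \<Longrightarrow> f (v i) = t i *s v i"
  shows "f = diag t"
  using assms by (intro linear_ext linear_diag) (auto simp: diag_basis)

lemma diag_inverse:
  assumes "\<And>i. i \<le> d \<Longrightarrow> t i \<noteq> 0"
  shows "bij (diag t)" and "inv_into UNIV (diag t) = diag (\<lambda>i. inverse (t i))"
proof -
  have l: "diag t (diag (\<lambda>i. inverse (t i)) x) = x" for x
    by (rule crd_ext) (simp add: assms)
  have r: "diag (\<lambda>i. inverse (t i)) (diag t x) = x" for x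
    by (rule crd_ext) (simp add: assms)
  show "bij (diag t)" by (rule bijI') (metis r, metis l)
  show "inv_into UNIV (diag t) = diag (\<lambda>i. inverse (t i))"
    by (rule inv_equality) (auto simp: l r)
qed

lemma matrix_of_entry:
  "i \<le> d \<Longrightarrow> j \<le> d \<Longrightarrow> matrix_of (*s) d v f $$ (i, j) = crd i (f (v j))"
  by (simp add: matrix_of_def crd_def)

lemma tridiagonal_entry:
  assumes "irreducible_tridiagonal_mat (matrix_of (*s) d v f)" "i \<le> d" "j \<le> d"
    and "i \<noteq> j" "i \<noteq> Suc j" "j \<noteq> Suc i"
  shows "crd i (f (v j)) = 0"
proof -
  have "dim_row (matrix_of (*s) d v f) = Suc d" "dim_col (matrix_of (*s) d v f) = Suc d"
    by (simp_all add: matrix_of_def)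
  then have "matrix_of (*s) d v f $$ (i, j) = 0"
    using assms unfolding irreducible_tridiagonal_mat_def tridiagonal_mat_def
    by (metis less_Suc_eq_le)
  then show ?thesis
    using matrix_of_entry assms(2,3) by simp
qed

text \<open>This is basis independence of the trace. If \<open>P\<close> and \<open>Q\<close> are the two mutually inverse
  change-of-basis matrices, the left-hand side is \<open>\<Sum>\<^sub>i \<Sum>\<^sub>j t\<^sub>j P\<^sub>j\<^sub>i Q\<^sub>i\<^sub>j\<close>, and summing over \<open>i\<close> first
  leaves the diagonal entries \<open>1\<close> of \<open>P Q\<close>.\<close>

lemma trace_eq_sum_eigenvalues:
  assumes "Vector_Spaces.linear (*s) (*s) f" and u: "ordered_basis (*s) d u"
    and eig: "\<And>j. j \<le> d \<Longrightarrow> f (u j) = t j *s u j"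
  shows "(\<Sum>i\<le>d. crd i (f (v i))) = (\<Sum>j\<le>d. t j)"
proof -
  interpret u: coordinates scale d u by unfold_locales fact
  have *: "crd i (f (v i)) = (\<Sum>j\<le>d. t j * (u.crd j (v i) * crd i (u j)))" for i
    by (subst u.linear_expand [OF assms(1)]) (auto simp: eig mult_ac intro!: sum.cong)
  have "(\<Sum>i\<le>d. crd i (f (v i))) = (\<Sum>j\<le>d. t j * (\<Sum>i\<le>d. u.crd j (v i) * crd i (u j)))"
    unfolding * by (subst sum.swap) (simp add: sum_distrib_left)
  also have "\<dots> = (\<Sum>j\<le>d. t j * u.crd j (\<Sum>i\<le>d. crd i (u j) *s v i))"
    by (simp add: mult_ac)
  also have "\<dots> = (\<Sum>j\<le>d. t j)"
    unfolding expand by (auto intro!: sum.cong)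
  finally show ?thesis .
qed

text \<open>Since the \<open>t j\<close> are distinct, the eigenspace for \<open>t i\<close> is the line through \<open>v i\<close>, and an
  idempotent with this range that kills the other eigenspaces has prescribed values on the basis.\<close>

lemma primitive_idempotent_eq_diag:
  assumes f: "f = diag t" and t: "inj_on t {..d}" and i: "i \<le> d"
  shows "primitive_idempotent (*s) f (t i) = diag (\<lambda>j. if j = i then 1 else 0)"
  unfolding primitive_idempotent_def
proof (rule the_equality)
  let ?E = "diag (\<lambda>j. if j = i then 1 else 0)"
  have eig: "x \<in> eigenspace (*s) f k \<longleftrightarrow> (\<forall>j\<le>d. t j = k \<or> crd j x = 0)" for x k
  proof
    assume "x \<in> eigenspace (*s) f k"
    then have "crd j (diag t x) = crd j (k *s x)" for j
      by (simp add: eigenspace_def f)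
    then show "\<forall>j\<le>d. t j = k \<or> crd j x = 0"
      by (metis crd_diag crd_scale mult_cancel_right)
  next
    assume *: "\<forall>j\<le>d. t j = k \<or> crd j x = 0"
    show "x \<in> eigenspace (*s) f k"
      unfolding eigenspace_def f mem_Collect_eq by (rule crd_ext) (use * in auto)
  qed
  have "range ?E = eigenspace (*s) f (t i)"
  proof
    show "range ?E \<subseteq> eigenspace (*s) f (t i)"
      by (auto simp: eig)
    show "eigenspace (*s) f (t i) \<subseteq> range ?E"
    proof
      fix x assume "x \<in> eigenspace (*s) f (t i)"
      then have "?E x = x"
        by (intro crd_ext) (use t i in \<open>auto simp: eig inj_on_def\<close>)
      then show "x \<in> range ?E" by (metis rangeI)
    qed
  qed
  moreover have "?E x = 0" if "l \<noteq> t i" "x \<in> eigenspace (*s) f l" for l x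
  proof -
    have "crd i x = 0" using that i by (auto simp: eig)
    then show ?thesis by (intro crd_ext) auto
  qed
  moreover have "?E \<circ> ?E = ?E"
    by (rule ext, rule crd_ext) simp
  ultimately show "Vector_Spaces.linear (*s) (*s) ?E \<and> ?E \<circ> ?E = ?E \<and>
      range ?E = eigenspace (*s) f (t i) \<and>
      (\<forall>l. l \<noteq> t i \<longrightarrow> (\<forall>x\<in>eigenspace (*s) f l. ?E x = 0))"
    using linear_diag by blast
next
  fix E
  assume E: "Vector_Spaces.linear (*s) (*s) E \<and> E \<circ> E = E \<and>
      range E = eigenspace (*s) f (t i) \<and>
      (\<forall>l. l \<noteq> t i \<longrightarrow> (\<forall>x\<in>eigenspace (*s) f l. E x = 0))"
  have v: "v j \<in> eigenspace (*s) f (t j)" if "j \<le> d" for j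
    using that by (simp add: eigenspace_def f diag_basis)
  show "E = diag (\<lambda>j. if j = i then 1 else 0)"
  proof (rule diag_unique)
    show "Vector_Spaces.linear (*s) (*s) E" using E by blast
    fix j assume j: "j \<le> d"
    show "E (v j) = (if j = i then 1 else 0) *s v j"
    proof (cases "j = i")
      case True
      with v [OF i] E obtain y where "v j = E y" by blast
      with E True show ?thesis by (metis comp_apply scale_one)
    next
      case False
      then have "t j \<noteq> t i" using t i j by (auto simp: inj_on_def)
      with E v [OF j] False show ?thesis by simp
    qed
  qed
qed

end

section \<open>The q-Racah parameters\<close>

text \<open>The eigenvalue of \<open>W\<close> on the \<open>\<theta>\<^sub>i\<close>-eigenspace of \<open>A\<close>.\<close>

definition W_weight :: "'a::field \<Rightarrow> 'a \<Rightarrow> nat \<Rightarrow> nat \<Rightarrow> 'a" where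
  "W_weight q a d i = (- 1) ^ i * a powi (- int i) * q powi (int i * (int d - int i))"

lemma W_weight_nonzero: "q \<noteq> 0 \<Longrightarrow> a \<noteq> 0 \<Longrightarrow> W_weight q a d i \<noteq> 0"
  by (simp add: W_weight_def)

text \<open>The quadratic exponent \<open>i (d - i)\<close> makes the ratio of consecutive weights geometric in \<open>i\<close>,
  which is what the off-diagonal entries of \<open>C\<close> relative to those of \<open>B\<close> require.\<close>

lemma W_weight_Suc:
  assumes "q \<noteq> 0" "a \<noteq> 0"
  shows "W_weight q a d i = - (a * q powi (2 * int i + 1 - int d)) * W_weight q a d (Suc i)"
proof -
  have 1: "int i * (int d - int i)
      = (2 * int i + 1 - int d) + int (Suc i) * (int d - int (Suc i))"
    by (simp add: algebra_simps)
  have 2: "a powi (- int i) = a * a powi (- int (Suc i))"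
    using assms by (subst power_int_add_1' [symmetric]) auto
  show ?thesis
    unfolding W_weight_def 1 2 using assms by (simp add: power_int_add mult_ac)
qed

text \<open>Both \<open>\<theta>\<^sub>i\<close> and \<open>\<theta>\<^sub>i\<^sub>+\<^sub>1\<close> are written in terms of the exponent halfway between them, so that the
  two \<open>q\<close>-commutator factors below each lose one of their two kinds of terms.\<close>

lemma qracah_eigenvalue_neighbours:
  fixes q a :: "'a::field" and i d :: nat
  defines "r \<equiv> a * q powi (2 * int i + 1 - int d)"
  assumes "q \<noteq> 0" "a \<noteq> 0"
  shows "qracah_eigenvalue q d a i = r / q + q / r"
    and "qracah_eigenvalue q d a (Suc i) = r * q + 1 / (r * q)"
proof -
  define y where "y = q powi (2 * int i + 1 - int d)"
  have y: "y \<noteq> 0" using assms by (simp add: y_def)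
  have e: "2 * int (Suc i) - int d = (2 * int i + 1 - int d) + 1"
    "int d - 2 * int (Suc i) = - (2 * int i + 1 - int d) - 1"
    "2 * int i - int d = (2 * int i + 1 - int d) - 1"
    "int d - 2 * int i = - (2 * int i + 1 - int d) + 1"
    by simp_all
  have "q powi (2 * int (Suc i) - int d) = y * q" "q powi (int d - 2 * int (Suc i)) = inverse y / q"
    "q powi (2 * int i - int d) = y / q" "q powi (int d - 2 * int i) = inverse y * q"
    unfolding e y_def using assms
    by (simp_all only: power_int_add power_int_diff power_int_minus power_int_1_right simp_thms)
  then show "qracah_eigenvalue q d a i = r / q + q / r"
    and "qracah_eigenvalue q d a (Suc i) = r * q + 1 / (r * q)"
    unfolding qracah_eigenvalue_def r_def y_def [symmetric]
    using assms y by (simp_all add: field_simps)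
qed

lemma qracah_eigenvalue_raise:
  fixes q a :: "'a::field"
  assumes "q \<noteq> 0" "a \<noteq> 0"
  shows "q * qracah_eigenvalue q d a (Suc i) - inverse q * qracah_eigenvalue q d a i
    = (q\<^sup>2 - inverse (q\<^sup>2)) * (a * q powi (2 * int i + 1 - int d))"
proof -
  define r where "r = a * q powi (2 * int i + 1 - int d)"
  have "r \<noteq> 0" using assms by (simp add: r_def)
  then show ?thesis
    unfolding qracah_eigenvalue_neighbours [OF assms, of d i, folded r_def] r_def [symmetric]
    using assms by (simp add: field_simps power2_eq_square)
qed

lemma qracah_eigenvalue_lower:
  fixes q a :: "'a::field"
  assumes "q \<noteq> 0" "a \<noteq> 0"
  shows "q * qracah_eigenvalue q d a i - inverse q * qracah_eigenvalue q d a (Suc i)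
    = (q\<^sup>2 - inverse (q\<^sup>2)) * inverse (a * q powi (2 * int i + 1 - int d))"
proof -
  define r where "r = a * q powi (2 * int i + 1 - int d)"
  have "r \<noteq> 0" using assms by (simp add: r_def)
  then show ?thesis
    unfolding qracah_eigenvalue_neighbours [OF assms, of d i, folded r_def] r_def [symmetric]
    using assms by (simp add: field_simps power2_eq_square)
qed

text \<open>Both halves of the eigenvalues sum to the same geometric series, by the symmetry
  \<open>i \<mapsto> d - i\<close>, and the series telescopes after multiplication by \<open>q - q\<^sup>-\<^sup>1\<close>.\<close>

lemma sum_qracah_eigenvalue:
  fixes q x :: "'a::field"
  assumes "q \<noteq> 0" "q\<^sup>2 \<noteq> 1"
  shows "(\<Sum>i\<le>d. qracah_eigenvalue q d x i) = (x + inverse x) * q_number q (int d + 1)"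
proof -
  have ne: "q - inverse q \<noteq> 0"
    using assms by (simp add: field_simps power2_eq_square)
  have tele: "(\<Sum>i\<le>d. q powi (2 * int i - int d)) * (q - inverse q)
      = q powi (int d + 1) - q powi (- (int d + 1))"
  proof -
    have "q powi (2 * int i - int d) * (q - inverse q)
        = q powi (2 * int (Suc i) - int d - 1) - q powi (2 * int i - int d - 1)" for i
    proof -
      have "2 * int (Suc i) - int d - 1 = (2 * int i - int d) + 1" by simp
      then show ?thesis
        using assms
        by (simp only: power_int_add power_int_diff power_int_1_right simp_thms)
           (simp add: field_simps)
    qed
    then have "(\<Sum>i\<le>d. q powi (2 * int i - int d)) * (q - inverse q)
        = (\<Sum>i\<le>d. q powi (2 * int (Suc i) - int d - 1) - q powi (2 * int i - int d - 1))"
      by (simp add: sum_distrib_right)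
    also have "\<dots> = q powi (2 * int (Suc d) - int d - 1) - q powi (2 * int 0 - int d - 1)"
      unfolding lessThan_Suc_atMost [symmetric] by (rule sum_lessThan_telescope)
    also have "2 * int (Suc d) - int d - 1 = int d + 1" by simp
    also have "2 * int 0 - int d - 1 = - (int d + 1)" by simp
    finally show ?thesis .
  qed
  have rev: "(\<Sum>i\<le>d. q powi (int d - 2 * int i)) = (\<Sum>i\<le>d. q powi (2 * int i - int d))"
    unfolding atMost_atLeast0
    by (rule sum.reindex_bij_witness [of _ "\<lambda>i. d - i" "\<lambda>i. d - i"])
       (auto simp: of_nat_diff algebra_simps)
  have "(\<Sum>i\<le>d. qracah_eigenvalue q d x i)
      = (x + inverse x) * (\<Sum>i\<le>d. q powi (2 * int i - int d))"
    unfolding qracah_eigenvalue_def sum.distrib sum_distrib_left [symmetric] rev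
    by (simp add: distrib_right)
  then show ?thesis
    using tele ne by (simp add: q_number_def eq_divide_eq)
qed

text \<open>With \<open>x = a q\<^sup>2\<^sup>i\<^sup>-\<^sup>d\<close>, the equation \<open>x + x\<^sup>-\<^sup>1 = q + q\<^sup>-\<^sup>1\<close> factors as
  \<open>(x - q) (x - q\<^sup>-\<^sup>1) = 0\<close>.\<close>

lemma qracah_eigenvalue_eq_iff:
  fixes q a :: "'a::field"
  assumes "q \<noteq> 0" "a \<noteq> 0"
  shows "qracah_eigenvalue q d a i = q + inverse q
    \<longleftrightarrow> a = q powi (int d + 1 - 2 * int i) \<or> a = q powi (int d - 1 - 2 * int i)"
proof -
  define y where "y = q powi (int d - 2 * int i)"
  have y: "y \<noteq> 0" using assms by (simp add: y_def)
  have "2 * int i - int d = - (int d - 2 * int i)" by simp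
  then have "qracah_eigenvalue q d a i = a * inverse y + inverse a * y"
    unfolding qracah_eigenvalue_def y_def by (simp only: power_int_minus)
  also have "\<dots> = q + inverse q \<longleftrightarrow> (a - y * q) * (a - y * inverse q) = 0"
    using assms y by (simp add: field_simps) algebra
  also have "\<dots> \<longleftrightarrow> a = y * q \<or> a = y * inverse q"
    by simp
  also have "y * q = q powi (int d - 2 * int i + 1)"
    unfolding y_def using assms by (simp add: power_int_add)
  also have "y * inverse q = q powi (int d - 2 * int i - 1)"
    unfolding y_def using assms by (simp add: power_int_diff [where n = 1] divide_inverse)
  finally show ?thesis by (simp add: algebra_simps)
qed

text \<open>The two solutions for \<open>a\<close> are powers of \<open>q\<close> whose exponents lie strictly between
  \<open>- d\<close> and \<open>d\<close>, where the restriction on \<open>a\<^sup>2\<close> excludes them, except at the ends of the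
  index range.\<close>

lemma qracah_eigenvalue_exceptional:
  fixes q a :: "'a::field"
  assumes "q \<noteq> 0" "a \<noteq> 0" "i \<le> d"
    and sq: "\<And>k. k \<in> {1 - int d..int d - 1} \<Longrightarrow> a\<^sup>2 \<noteq> q powi (2 * k)"
    and "qracah_eigenvalue q d a i = q + inverse q"
  shows "i = 0 \<and> a = q powi (int d + 1) \<or> i = d \<and> a = q powi (- int d - 1)"
proof -
  have no: "k \<notin> {1 - int d..int d - 1}" if "a = q powi k" for k
    using sq [of k] that by (auto simp: power_int_mult power_int_power mult.commute)
  have "a = q powi (int d + 1 - 2 * int i) \<or> a = q powi (int d - 1 - 2 * int i)"
    using assms qracah_eigenvalue_eq_iff by blast
  then show ?thesis
  proof
    assume a: "a = q powi (int d + 1 - 2 * int i)"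
    have "i = 0" using no [OF a] \<open>i \<le> d\<close> by auto
    with a show ?thesis by simp
  next
    assume a: "a = q powi (int d - 1 - 2 * int i)"
    have "i = d" using no [OF a] \<open>i \<le> d\<close> by auto
    then have "int d - 1 - 2 * int i = - int d - 1" by simp
    with a have "a = q powi (- int d - 1)" by (simp only:)
    with \<open>i = d\<close> show ?thesis by blast
  qed
qed

section \<open>Conjugation by W\<close>

context coordinates
begin

lemma qracah_relation_entry:
  assumes "qracah_relation (*s) q \<alpha> X Y Z"
  shows "crd i (X x) + inverse (q\<^sup>2 - inverse (q\<^sup>2)) * (q * crd i (Y (Z x)) - inverse q * crd i (Z (Y x)))
    = \<alpha> * crd i x"
proof -
  have "crd i (X x + inverse (q\<^sup>2 - inverse (q\<^sup>2)) *s (q *s Y (Z x) - inverse q *s Z (Y x)))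
      = crd i (\<alpha> *s x)"
    using assms by (simp add: qracah_relation_def)
  then show ?thesis by simp
qed

lemma entry_from_relation:
  assumes "Vector_Spaces.linear (*s) (*s) B"
    and rel: "qracah_relation (*s) q \<gamma> C (diag \<theta>) B" and "i \<le> d" "j \<le> d"
  shows "crd i (C (v j)) = (if i = j then \<gamma> else 0)
    - inverse (q\<^sup>2 - inverse (q\<^sup>2)) * (q * \<theta> i - inverse q * \<theta> j) * crd i (B (v j))"
proof -
  interpret B: Vector_Spaces.linear "(*s)" "(*s)" B by fact
  show ?thesis
    using qracah_relation_entry [OF rel, of i "v j"] assms(3,4)
    by (simp add: diag_basis B.scale algebra_simps split: if_splits)
qed

text \<open>This is \<open>B W = W (C + D)\<close> with \<open>D\<close> diagonal, compared entry by entry: on the diagonal it holds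
  by the choice of \<open>D\<close>, next to it because the weights match the eigenvalues of \<open>A\<close>, and elsewhere
  both sides vanish, \<open>C\<close> inheriting the zeros of \<open>B\<close> through the relation.\<close>

lemma conjugate_diagonal:
  assumes q: "q \<noteq> 0" "q\<^sup>2 - inverse (q\<^sup>2) \<noteq> 0" and a: "a \<noteq> 0"
    and B: "Vector_Spaces.linear (*s) (*s) B" and C: "Vector_Spaces.linear (*s) (*s) C"
    and tri: "irreducible_tridiagonal_mat (matrix_of (*s) d v B)"
    and rel: "qracah_relation (*s) q \<gamma> C (diag (qracah_eigenvalue q d a)) B"
  shows "B (diag (W_weight q a d) x) = diag (W_weight q a d)
    (C x + diag (\<lambda>j. crd j (B (v j)) - crd j (C (v j))) x)"
proof -
  let ?w = "W_weight q a d" and ?D = "diag (\<lambda>j. crd j (B (v j)) - crd j (C (v j)))"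
  interpret B: Vector_Spaces.linear "(*s)" "(*s)" B by fact
  interpret C: Vector_Spaces.linear "(*s)" "(*s)" C by fact
  interpret W: Vector_Spaces.linear "(*s)" "(*s)" "diag ?w" by (rule linear_diag)
  interpret D: Vector_Spaces.linear "(*s)" "(*s)" ?D by (rule linear_diag)
  \<comment> \<open>the common ratio that governs both the weights and the entries of \<open>C\<close> next to the diagonal\<close>
  define r where "r i = a * q powi (2 * int i + 1 - int d)" for i
  have r: "r i \<noteq> 0" for i using q a by (simp add: r_def)
  have w: "?w i = - r i * ?w (Suc i)" for i
    unfolding r_def by (rule W_weight_Suc [OF q(1) a])
  note C_entry = entry_from_relation [OF B rel]
  have entry: "?w j * crd i (B (v j))
      = ?w i * (crd i (C (v j)) + (if i = j then crd j (B (v j)) - crd j (C (v j)) else 0))"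
    if ij: "i \<le> d" "j \<le> d" for i j
  proof -
    consider "i = j" | "i = Suc j" | "j = Suc i" | "i \<noteq> j" "i \<noteq> Suc j" "j \<noteq> Suc i" by blast
    then show ?thesis
    proof cases
      case 1
      then show ?thesis by simp
    next
      case 2
      then have "crd i (C (v j)) = - r j * crd i (B (v j))"
        using C_entry [OF ij] q
        by (simp add: qracah_eigenvalue_raise [OF q(1) a] r_def)
      with 2 show ?thesis by (simp add: w [of j])
    next
      case 3
      then have "crd i (C (v j)) = - inverse (r i) * crd i (B (v j))"
        using C_entry [OF ij] q
        by (simp add: qracah_eigenvalue_lower [OF q(1) a] r_def)
      with 3 show ?thesis using r [of i] by (simp add: w [of i])
    next
      case 4
      then have "crd i (B (v j)) = 0" using tridiagonal_entry [OF tri ij] by blast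
      with 4 show ?thesis using C_entry [OF ij] by simp
    qed
  qed
  have "B \<circ> diag ?w = (\<lambda>x. diag ?w (C x + ?D x))"
  proof (rule linear_ext)
    show "Vector_Spaces.linear (*s) (*s) (B \<circ> diag ?w)"
      by (rule linear_if_add_scale) (simp_all add: B.add B.scale W.add W.scale)
    show "Vector_Spaces.linear (*s) (*s) (\<lambda>x. diag ?w (C x + ?D x))"
      by (rule linear_if_add_scale) (simp_all add: C.add C.scale D.add D.scale W.add W.scale scale_right_distrib)
    fix j assume j: "j \<le> d"
    show "(B \<circ> diag ?w) (v j) = diag ?w (C (v j) + ?D (v j))"
    proof (rule crd_ext)
      fix i assume "i \<le> d"
      with entry [OF this j] j
      show "crd i ((B \<circ> diag ?w) (v j)) = crd i (diag ?w (C (v j) + ?D (v j)))"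
        by (auto simp: diag_basis B.scale)
    qed
  qed
  then show ?thesis by (metis comp_apply)
qed

text \<open>On the diagonal, a q-commutator with a diagonal map is a multiplication, and
  \<open>(q - q\<^sup>-\<^sup>1)/(q\<^sup>2 - q\<^sup>-\<^sup>2) = 1/(q + q\<^sup>-\<^sup>1)\<close>. So the two relations read
  \<open>B\<^sub>j\<^sub>j + \<theta>\<^sub>j C\<^sub>j\<^sub>j/(q + q\<^sup>-\<^sup>1) = \<beta>\<close> and \<open>C\<^sub>j\<^sub>j + \<theta>\<^sub>j B\<^sub>j\<^sub>j/(q + q\<^sup>-\<^sup>1) = \<gamma>\<close>, to be subtracted.\<close>

lemma diagonal_difference:
  assumes q: "q \<noteq> 0" "q\<^sup>2 - inverse (q\<^sup>2) \<noteq> 0"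
    and B: "Vector_Spaces.linear (*s) (*s) B" and C: "Vector_Spaces.linear (*s) (*s) C"
    and rel_B: "qracah_relation (*s) q \<beta> B C (diag \<theta>)"
    and rel_C: "qracah_relation (*s) q \<gamma> C (diag \<theta>) B" and j: "j \<le> d"
  shows "(crd j (B (v j)) - crd j (C (v j))) * (1 - inverse (q + inverse q) * \<theta> j) = \<beta> - \<gamma>"
proof -
  interpret B: Vector_Spaces.linear "(*s)" "(*s)" B by fact
  interpret C: Vector_Spaces.linear "(*s)" "(*s)" C by fact
  have "q\<^sup>2 - inverse (q\<^sup>2) = (q - inverse q) * (q + inverse q)"
    using q by (simp add: field_simps power2_eq_square)
  then have k: "inverse (q\<^sup>2 - inverse (q\<^sup>2)) * (q - inverse q) = inverse (q + inverse q)"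
    using q by auto
  have "crd j (B (v j)) + inverse (q\<^sup>2 - inverse (q\<^sup>2)) * (q - inverse q) * \<theta> j * crd j (C (v j)) = \<beta>"
    using qracah_relation_entry [OF rel_B, of j "v j"] j
    by (simp add: diag_basis C.scale algebra_simps)
  moreover have "crd j (C (v j)) + inverse (q\<^sup>2 - inverse (q\<^sup>2)) * (q - inverse q) * \<theta> j * crd j (B (v j)) = \<gamma>"
    using qracah_relation_entry [OF rel_C, of j "v j"] j
    by (simp add: diag_basis B.scale algebra_simps)
  ultimately show ?thesis unfolding k by (auto simp: algebra_simps)
qed

end

section \<open>The conjugated difference in terms of A\<close>

theorem proposition8p11:
  fixes scale :: "'a::field \<Rightarrow> 'v::ab_group_add \<Rightarrow> 'v"
    and q a b c :: 'a and d :: nat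
    and A B C :: "'v \<Rightarrow> 'v"
  assumes "vector_space scale"
    and "vector_space.dim scale (UNIV :: 'v set) = d + 1"
    and "q \<noteq> 0" and "q ^ 4 \<noteq> 1"
    and "a \<noteq> 0" and "b \<noteq> 0" and "c \<noteq> 0"
    and "\<And>i. 1 \<le> i \<Longrightarrow> i \<le> d \<Longrightarrow> q ^ (2 * i) \<noteq> 1"
    and "\<And>x k. x \<in> {a, b, c} \<Longrightarrow> k \<in> {1 - int d..int d - 1} \<Longrightarrow> x\<^sup>2 \<noteq> q powi (2 * k)"
    and "\<And>x j. x \<in> {a * b * c, inverse a * b * c, a * inverse b * c, a * b * inverse c} \<Longrightarrow>
           j < d \<Longrightarrow> x \<noteq> q powi (int d - 1 - 2 * int j)"
    and "qracah_huang_data scale q a b c d A B C"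
  shows "(a = q powi (int d + 1) \<longrightarrow>
            A_bar scale q a d A B C =
              (\<lambda>v. scale ((b - c) * (b - inverse c) * inverse b * q_number q (int d + 1))
                     (qracah_idempotent scale q a d A 0 v))) \<and>
         (a = q powi (- int d - 1) \<longrightarrow>
            A_bar scale q a d A B C =
              (\<lambda>v. scale ((b - c) * (b - inverse c) * inverse b * q_number q (int d + 1))
                     (qracah_idempotent scale q a d A d v))) \<and>
         (a \<noteq> q powi (int d + 1) \<and> a \<noteq> q powi (- int d - 1) \<longrightarrow>
            bij (\<lambda>v. v - scale (inverse (q + inverse q)) (A v)) \<and>
            A_bar scale q a d A B C =
              (\<lambda>v. scale (qracah_alpha q d b c a - qracah_alpha q d c a b)
                     (inv_into UNIV (\<lambda>u. u - scale (inverse (q + inverse q)) (A u)) v)))"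
proof -
  let ?\<theta> = "qracah_eigenvalue q d a"
  let ?\<beta> = "qracah_alpha q d b c a" and ?\<gamma> = "qracah_alpha q d c a b"
  note data = assms(11) [unfolded qracah_huang_data_def leonard_triple_def standard_ordering_def]
  from data have linear: "Vector_Spaces.linear scale scale A" "Vector_Spaces.linear scale scale B"
      "Vector_Spaces.linear scale scale C"
    and rel: "qracah_relation scale q ?\<beta> B C A" "qracah_relation scale q ?\<gamma> C A B"
    and inj_\<theta>: "inj_on ?\<theta> {..d}"
    by (auto simp: bij_betw_def)
  from data obtain v where v: "\<And>i. i \<le> d \<Longrightarrow> A (v i) = scale (?\<theta> i) (v i)"
      "leonard_basis scale d A B C v"
    by (auto simp: eigenspace_def)
  from data obtain v' where v': "\<And>i. i \<le> d \<Longrightarrow> B (v' i) = scale (qracah_eigenvalue q d b i) (v' i)"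
      "leonard_basis scale d B C A v'"
    by (auto simp: eigenspace_def)
  from data obtain v'' where v'': "\<And>i. i \<le> d \<Longrightarrow> C (v'' i) = scale (qracah_eigenvalue q d c i) (v'' i)"
      "leonard_basis scale d C A B v''"
    by (auto simp: eigenspace_def)
  interpret vector_space scale by fact
  interpret coordinates scale d v
    using v(2) by unfold_locales (simp add: leonard_basis_def)
  have q: "q \<noteq> 0" "q\<^sup>2 - inverse (q\<^sup>2) \<noteq> 0" "q\<^sup>2 \<noteq> 1" and a: "a \<noteq> 0"
    using assms(3-5) by (auto simp: field_simps power2_eq_square power4_eq_xxxx)
  have q': "q + inverse q \<noteq> 0"
  proof
    assume "q + inverse q = 0"
    then have "q\<^sup>2 = - 1" using q(1) by (simp add: field_simps power2_eq_square eq_neg_iff_add_eq_0)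
    then have "q ^ 4 = 1" by (metis power_mult [of q 2 2] mult_2 numeral_Bit0 power2_minus one_power2)
    then show False using assms(4) by contradiction
  qed
  have A: "A = diag ?\<theta>"
    using linear(1) v(1) by (rule diag_unique)
  have E: "qracah_idempotent scale q a d A i = diag (\<lambda>j. if j = i then 1 else 0)" if "i \<le> d" for i
    unfolding qracah_idempotent_def using A inj_\<theta> that by (rule primitive_idempotent_eq_diag)
  have W: "W_map scale q a d A = diag (W_weight q a d)"
  proof (intro ext crd_ext)
    fix x i assume "i \<le> d"
    have "crd i (W_map scale q a d A x)
        = (\<Sum>j\<le>d. if j = i then W_weight q a d i * crd i x else 0)"
      unfolding W_map_def crd_sum
      using \<open>i \<le> d\<close> by (intro sum.cong) (simp_all add: E W_weight_def)
    then show "crd i (W_map scale q a d A x) = crd i (diag (W_weight q a d) x)"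
      using \<open>i \<le> d\<close> by simp
  qed
  define \<delta> where "\<delta> j = crd j (B (v j)) - crd j (C (v j))" for j
  have tri: "irreducible_tridiagonal_mat (matrix_of scale d v B)"
    using v(2) by (simp add: leonard_basis_def)
  have A_bar: "A_bar scale q a d A B C = diag \<delta>"
  proof
    fix x
    have "inj (diag (W_weight q a d))"
      by (intro bij_is_inj diag_inverse W_weight_nonzero q a)
    moreover have "B (diag (W_weight q a d) x) = diag (W_weight q a d) (C x + diag \<delta> x)"
      unfolding \<delta>_def using q(1,2) a linear(2,3) tri rel(2) [unfolded A] by (rule conjugate_diagonal)
    ultimately show "A_bar scale q a d A B C x = diag \<delta> x"
      by (simp add: A_bar_def W)
  qed
  have \<delta>: "\<delta> j * (1 - inverse (q + inverse q) * ?\<theta> j) = ?\<beta> - ?\<gamma>" if "j \<le> d" for j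
    unfolding \<delta>_def using q(1,2) linear(2,3) rel [unfolded A] that by (rule diagonal_difference)
  have factor: "1 - inverse (q + inverse q) * ?\<theta> j = 0 \<longleftrightarrow> ?\<theta> j = q + inverse q" for j
    using q' by (auto simp: field_simps)
  have trace: "(\<Sum>j\<le>d. \<delta> j) = (b - c) * (b - inverse c) * inverse b * q_number q (int d + 1)"
  proof -
    have basis': "ordered_basis scale d v'" and basis'': "ordered_basis scale d v''"
      using v'(2) v''(2) by (simp_all add: leonard_basis_def)
    have "(\<Sum>j\<le>d. \<delta> j)
        = (\<Sum>j\<le>d. qracah_eigenvalue q d b j) - (\<Sum>j\<le>d. qracah_eigenvalue q d c j)"
      unfolding \<delta>_def sum_subtractf
      by (simp only: trace_eq_sum_eigenvalues [OF linear(2) basis', OF v'(1)]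
          trace_eq_sum_eigenvalues [OF linear(3) basis'', OF v''(1)])
    also have "\<dots> = (b + inverse b - (c + inverse c)) * q_number q (int d + 1)"
      by (simp only: sum_qracah_eigenvalue [OF q(1,3)] left_diff_distrib)
    also have "b + inverse b - (c + inverse c) = (b - c) * (b - inverse c) * inverse b"
      using assms(6,7) by (simp add: field_simps)
    finally show ?thesis .
  qed
  \<comment> \<open>If \<open>\<theta>\<^sub>i = q + q\<^sup>-\<^sup>1\<close>, the equation for \<open>\<delta>\<^sub>i\<close> forces \<open>\<beta> = \<gamma>\<close>, and those
    with \<open>j \<noteq> i\<close> then force \<open>\<delta>\<^sub>j = 0\<close>, so the trace is the single remaining entry \<open>\<delta>\<^sub>i\<close>.\<close>
  have exceptional: "A_bar scale q a d A B C =
      (\<lambda>x. scale ((b - c) * (b - inverse c) * inverse b * q_number q (int d + 1))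
        (qracah_idempotent scale q a d A i x))"
    if i: "i \<le> d" "?\<theta> i = q + inverse q" for i
  proof -
    have "?\<beta> - ?\<gamma> = 0"
      using \<delta> [OF i(1)] factor i(2) by (metis mult_zero_right)
    then have zero: "\<delta> j = 0" if "j \<le> d" "j \<noteq> i" for j
    proof -
      have "?\<theta> j \<noteq> ?\<theta> i" using inj_\<theta> i(1) that by (simp add: inj_on_eq_iff)
      then have "1 - inverse (q + inverse q) * ?\<theta> j \<noteq> 0" using factor i(2) by simp
      then show ?thesis
        using \<delta> [OF that(1)] \<open>?\<beta> - ?\<gamma> = 0\<close> by (metis mult_eq_0_iff)
    qed
    have "(\<Sum>j\<le>d. \<delta> j) = (\<Sum>j\<in>{i}. \<delta> j)"
      using i(1) zero by (intro sum.mono_neutral_right) auto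
    then have "\<delta> i = (b - c) * (b - inverse c) * inverse b * q_number q (int d + 1)"
      using trace by simp
    then show ?thesis
      unfolding A_bar E [OF i(1)] by (intro ext crd_ext) (simp add: zero)
  qed
  show ?thesis
  proof (intro conjI impI)
    assume "a = q powi (int d + 1)"
    then have "?\<theta> 0 = q + inverse q"
      using qracah_eigenvalue_eq_iff [OF q(1) a, of d 0] by simp
    then show "A_bar scale q a d A B C =
        (\<lambda>v. scale ((b - c) * (b - inverse c) * inverse b * q_number q (int d + 1))
          (qracah_idempotent scale q a d A 0 v))"
      by (intro exceptional) auto
  next
    assume "a = q powi (- int d - 1)"
    then have "?\<theta> d = q + inverse q"
      using qracah_eigenvalue_eq_iff [OF q(1) a, of d d] by simp
    then show "A_bar scale q a d A B C =
        (\<lambda>v. scale ((b - c) * (b - inverse c) * inverse b * q_number q (int d + 1))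
          (qracah_idempotent scale q a d A d v))"
      by (intro exceptional) auto
  next
    assume generic: "a \<noteq> q powi (int d + 1) \<and> a \<noteq> q powi (- int d - 1)"
    define t where "t j = 1 - inverse (q + inverse q) * ?\<theta> j" for j
    have t: "t j \<noteq> 0" if "j \<le> d" for j
      using qracah_eigenvalue_exceptional [OF q(1) a that] assms(9) [of a] generic factor [of j]
      unfolding t_def by blast
    have resolvent: "(\<lambda>v. v - scale (inverse (q + inverse q)) (A v)) = diag t"
      by (intro ext crd_ext) (simp add: A t_def algebra_simps)
    show "bij (\<lambda>v. v - scale (inverse (q + inverse q)) (A v))"
      unfolding resolvent using t by (rule diag_inverse)
    have inverse: "inv_into UNIV (diag t) = diag (\<lambda>j. inverse (t j))"
      using t by (rule diag_inverse)
    have "\<delta> j = (?\<beta> - ?\<gamma>) * inverse (t j)" if "j \<le> d" for j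
      using \<delta> [OF that] t [OF that] by (simp add: t_def field_simps)
    then show "A_bar scale q a d A B C =
        (\<lambda>v. scale (?\<beta> - ?\<gamma>)
          (inv_into UNIV (\<lambda>u. u - scale (inverse (q + inverse q)) (A u)) v))"
      unfolding A_bar resolvent inverse by (intro ext crd_ext) simp
  qed
qed

end
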